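(* There exists an absolute constant $C>0$ such that the following holds. Let $\tau,n,m,t\in\mathbb{N}^+$, let $W_1,\dots,W_\tau\in\mathbb{R}^{n\times m}$ be matrices, let $\alpha_1,\dots,\alpha_\tau\ge 0$ be weights, and let $S_1,\dots,S_\tau\in\mathbb{R}^{t\times n}$ be mutually independent CountSketch matrices, each with sketch size $t$. Then for any fixed $\theta\in\mathbb{R}^m$, with probability at least $0.99$, \[ \left|\,\Big\|\Big(\sum_{i=1}^{\tau}\sqrt{\alpha_i}\,S_iW_i\Big)\theta\Big\|_2^2-\sum_{i=1}^{\tau}\alpha_i\|W_i\theta\|_2^2\right|\le \frac{C}{\sqrt{t}}\sum_{i=1}^{\tau}\alpha_i\|W_i\theta\|_2^2 . \]
   Context: A CountSketch matrix $S\in\mathbb{R}^{t\times n}$ with sketch size $t$ is defined as follows: draw a 2-wise independent hash function $h:[n]\to[t]$ (so each $h(k)$ is uniformly distributed on $[t]$ and the values are pairwise independent) and, independently, a 4-wise independent hash function $\sigma:[n]\to\{-1,1\}$ (each $\sigma(k)$ uniform on $\{-1,1\}$, any four values independent). Then $S_{k,j}=\sigma(j)$ if $h(j)=k$ and $S_{k,j}=0$ otherwise; equivalently $(Sy)_k=\sum_{j:\,h(j)=k}\sigma(j)\,(y)_j$. The probability is over the randomness of $S_1,\dots,S_\tau$. *)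

theory Defs
  imports "HOL-Probability.Probability"
begin

text \<open>Vectors in R^d are functions nat => real, meaningful on indices < d;
 matrices in R^(r x c) are functions nat => nat => real on indices < r, < c.\<close>

definition mat_vec :: "nat \<Rightarrow> (nat \<Rightarrow> nat \<Rightarrow> real) \<Rightarrow> (nat \<Rightarrow> real) \<Rightarrow> nat \<Rightarrow> real" where
  "mat_vec m W x = (\<lambda>r. \<Sum>c<m. W r c * x c)"

definition sqnorm :: "nat \<Rightarrow> (nat \<Rightarrow> real) \<Rightarrow> real" where
  "sqnorm d x = (\<Sum>k<d. (x k)^2)"

definition countsketch_apply :: "nat \<Rightarrow> (nat \<Rightarrow> nat) \<Rightarrow> (nat \<Rightarrow> real) \<Rightarrow> (nat \<Rightarrow> real) \<Rightarrow> nat \<Rightarrow> real" where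
  "countsketch_apply n h s y = (\<lambda>k. \<Sum>j\<in>{j. j < n \<and> h j = k}. s j * y j)"

text \<open>Random outcome \<omega> :: nat => nat => nat * real:  fst (\<omega> i k) = h_i(k), snd (\<omega> i k) = \<sigma>_i(k).
  The i-th hash block and the i-th sign block, as random vectors indexed by [n].\<close>
definition cs_block :: "nat \<Rightarrow> nat \<times> bool \<Rightarrow> (nat \<Rightarrow> nat \<Rightarrow> nat \<times> real) \<Rightarrow> nat \<Rightarrow> nat \<times> real" where
  "cs_block n ib \<omega> = (case ib of (i, b) \<Rightarrow>
      restrict (\<lambda>k. if b then (0, snd (\<omega> i k)) else (fst (\<omega> i k), 0)) {..<n})"

definition countsketch_family ::
  "nat \<Rightarrow> nat \<Rightarrow> nat \<Rightarrow> (nat \<Rightarrow> nat \<Rightarrow> nat \<times> real) pmf \<Rightarrow> bool" where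
  "countsketch_family \<tau> n t p \<longleftrightarrow>
     (\<forall>i<\<tau>. \<forall>k<n. \<forall>j<t. measure_pmf.prob p {\<omega>. fst (\<omega> i k) = j} = 1 / real t)
   \<and> (\<forall>i<\<tau>. \<forall>J. J \<subseteq> {..<n} \<and> card J \<le> 2 \<longrightarrow>
        prob_space.indep_vars (measure_pmf p) (\<lambda>_. count_space UNIV) (\<lambda>k \<omega>. fst (\<omega> i k)) J)
   \<and> (\<forall>i<\<tau>. \<forall>k<n. measure_pmf.prob p {\<omega>. snd (\<omega> i k) = 1} = 1/2
                 \<and> measure_pmf.prob p {\<omega>. snd (\<omega> i k) = -1} = 1/2)
   \<and> (\<forall>i<\<tau>. \<forall>J. J \<subseteq> {..<n} \<and> card J \<le> 4 \<longrightarrow>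
        prob_space.indep_vars (measure_pmf p) (\<lambda>_. count_space UNIV) (\<lambda>k \<omega>. snd (\<omega> i k)) J)
   \<and> prob_space.indep_vars (measure_pmf p) (\<lambda>_. count_space UNIV) (cs_block n) ({..<\<tau>} \<times> UNIV)"

end

theory Submission
  imports Defs
begin

text \<open>With \<open>z\<^sub>a = sqrt \<alpha>\<^sub>i * (W\<^sub>i \<theta>)\<^sub>j\<close> for \<open>a = (i, j)\<close>, the squared norm of the sketch is almost
  surely \<open>\<Sum>\<^sub>a z\<^sub>a\<^sup>2\<close> plus the off-diagonal sum of \<open>z\<^sub>a z\<^sub>b \<sigma>\<^sub>a \<sigma>\<^sub>b\<close> over colliding pairs \<open>a \<noteq> b\<close>.
  In the second moment of that sum, a product of two cross terms has mean zero unless the two pairs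
  agree up to order, and colliding has probability \<open>1/t\<close>; so the second moment is at most
  \<open>2/t (\<Sum>\<^sub>a z\<^sub>a\<^sup>2)\<^sup>2\<close>, and Chebyshev's inequality with \<open>C = 15\<close> leaves a failure probability of at
  most \<open>2/225\<close>.\<close>

text \<open>Agrees with a sign hash value almost surely, but is bounded by 1 everywhere, which makes all
  the integrals below trivially integrable.\<close>

definition signum1 :: "real \<Rightarrow> real" where
  "signum1 r = (if r = 1 then 1 else -1)"

definition hash_at :: "nat \<times> nat \<Rightarrow> (nat \<Rightarrow> nat \<Rightarrow> nat \<times> real) \<Rightarrow> nat" where
  "hash_at a \<omega> = fst (\<omega> (fst a) (snd a))"

definition sign_at :: "nat \<times> nat \<Rightarrow> (nat \<Rightarrow> nat \<Rightarrow> nat \<times> real) \<Rightarrow> real" where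
  "sign_at a \<omega> = signum1 (snd (\<omega> (fst a) (snd a)))"

text \<open>The indicator of a common bucket, kept as a sum over buckets of products. This is the
  shape that arises when the squared norm is expanded coordinatewise, and each factor depends on a
  single hash value, as independence and measurability arguments require.\<close>

definition collide :: "nat \<Rightarrow> nat \<Rightarrow> nat \<Rightarrow> real" where
  "collide t u v = (\<Sum>k<t. of_bool (u = k) * of_bool (v = k))"

lemma collide_eq: "collide t u v = of_bool (u = v \<and> u < t)"
  by (auto simp: collide_def of_bool_def if_distrib[where f = "\<lambda>x. _ * x"] cong: if_cong)

lemma abs_collide_le: "\<bar>collide t u v\<bar> \<le> 1"
  by (simp add: collide_eq)

lemma collide_commute: "collide t u v = collide t v u"
  by (auto simp: collide_eq)

lemma abs_signum1 [simp]: "\<bar>signum1 r\<bar> = 1"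
  by (simp add: signum1_def)

lemma abs_sign_at [simp]: "\<bar>sign_at a \<omega>\<bar> = 1"
  by (simp add: sign_at_def)

lemma sign_at_mult_self [simp]: "sign_at a \<omega> * sign_at a \<omega> = 1"
  by (simp add: sign_at_def signum1_def)

lemma abs_mult_le_1: "\<bar>a\<bar> \<le> 1 \<Longrightarrow> \<bar>b\<bar> \<le> 1 \<Longrightarrow> \<bar>a * b\<bar> \<le> (1::real)"
  by (simp add: abs_mult mult_le_one)

section \<open>Expectations of products over disjoint index sets\<close>

lemma borel_measurable_PiM_component:
  assumes "i \<in> A"
  shows "(\<lambda>f. u (f i)) \<in> borel_measurable (PiM A (\<lambda>_. count_space UNIV))"
  by (rule measurable_compose[OF measurable_component_singleton[OF assms]]) simp

text \<open>Restrictions of an independent family to disjoint index sets are independent, hence so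
  are measurable functions of them. The bound 1 supplies integrability. All uses of independence
  below, between blocks and within one block, go through this rule.\<close>

lemma (in prob_space) expectation_mult_disjoint:
  fixes f g :: "('i \<Rightarrow> 'b) \<Rightarrow> real"
  assumes ind: "indep_vars (\<lambda>_. count_space UNIV) X I"
    and AB: "A \<inter> B = {}" "A \<subseteq> I" "B \<subseteq> I"
    and f: "f \<in> borel_measurable (PiM A (\<lambda>_. count_space UNIV))" "\<And>x. \<bar>f x\<bar> \<le> 1"
    and g: "g \<in> borel_measurable (PiM B (\<lambda>_. count_space UNIV))" "\<And>x. \<bar>g x\<bar> \<le> 1"
  shows "expectation (\<lambda>\<omega>. f (restrict (\<lambda>i. X i \<omega>) A) * g (restrict (\<lambda>i. X i \<omega>) B)) =
    expectation (\<lambda>\<omega>. f (restrict (\<lambda>i. X i \<omega>) A)) *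
    expectation (\<lambda>\<omega>. g (restrict (\<lambda>i. X i \<omega>) B))"
proof -
  have iv: "indep_var borel (\<lambda>\<omega>. f (restrict (\<lambda>i. X i \<omega>) A))
      borel (\<lambda>\<omega>. g (restrict (\<lambda>i. X i \<omega>) B))"
    using indep_var_compose[OF indep_var_restrict[OF ind AB] f(1) g(1)] by (simp add: comp_def)
  show ?thesis
    by (intro indep_var_lebesgue_integral iv integrable_const_bound[where B = 1])
      (use iv f(2) g(2) in \<open>auto dest: indep_var_rv1 indep_var_rv2\<close>)
qed

lemma measure_pmf_integrable_bounded:
  fixes f :: "'a \<Rightarrow> real"
  assumes "\<And>x. \<bar>f x\<bar> \<le> B"
  shows "integrable (measure_pmf p) f"
  by (rule measure_pmf.integrable_const_bound[where B = B]) (use assms in auto)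

section \<open>Distribution of single hash and sign values\<close>

locale countsketch =
  fixes \<tau> n t :: nat and p :: "(nat \<Rightarrow> nat \<Rightarrow> nat \<times> real) pmf"
  assumes family: "countsketch_family \<tau> n t p"
    and t_pos: "0 < t"
begin

abbreviation Idx :: "(nat \<times> nat) set" where
  "Idx \<equiv> {..<\<tau>} \<times> {..<n}"

lemma prob_hash: "i < \<tau> \<Longrightarrow> k < n \<Longrightarrow> j < t \<Longrightarrow>
    measure_pmf.prob p {\<omega>. fst (\<omega> i k) = j} = 1 / real t"
  and indep_hash: "i < \<tau> \<Longrightarrow> J \<subseteq> {..<n} \<Longrightarrow> card J \<le> 2 \<Longrightarrow>
    prob_space.indep_vars (measure_pmf p) (\<lambda>_. count_space UNIV) (\<lambda>k \<omega>. fst (\<omega> i k)) J"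
  and prob_sign_pos: "i < \<tau> \<Longrightarrow> k < n \<Longrightarrow> measure_pmf.prob p {\<omega>. snd (\<omega> i k) = 1} = 1/2"
  and prob_sign_neg: "i < \<tau> \<Longrightarrow> k < n \<Longrightarrow> measure_pmf.prob p {\<omega>. snd (\<omega> i k) = -1} = 1/2"
  and indep_sign: "i < \<tau> \<Longrightarrow> J \<subseteq> {..<n} \<Longrightarrow> card J \<le> 4 \<Longrightarrow>
    prob_space.indep_vars (measure_pmf p) (\<lambda>_. count_space UNIV) (\<lambda>k \<omega>. snd (\<omega> i k)) J"
  and indep_blocks: "prob_space.indep_vars (measure_pmf p) (\<lambda>_. count_space UNIV)
    (cs_block n) ({..<\<tau>} \<times> UNIV)"
  using family by (simp_all add: countsketch_family_def)

text \<open>The \<open>t\<close> buckets carry mass \<open>1/t\<close> each, which already exhausts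
  the total mass 1, so values outside the range form a null set.\<close>

lemma AE_hash_less:
  assumes "a \<in> Idx"
  shows "AE \<omega> in measure_pmf p. hash_at a \<omega> < t"
proof -
  have "{\<omega>. hash_at a \<omega> < t} = (\<Union>j<t. {\<omega>. hash_at a \<omega> = j})"
    by auto
  then have "measure_pmf.prob p {\<omega>. hash_at a \<omega> < t} =
      (\<Sum>j<t. measure_pmf.prob p {\<omega>. hash_at a \<omega> = j})"
    by (simp, intro measure_pmf.finite_measure_finite_Union) (auto simp: disjoint_family_on_def)
  also have "\<dots> = 1"
    using assms t_pos by (auto simp: hash_at_def prob_hash)
  finally show ?thesis
    using measure_pmf.prob_Collect_eq_1[of p "\<lambda>\<omega>. hash_at a \<omega> < t"] by simp
qed

text \<open>The masses at 1 and -1 add up to 1, and on these two values \<open>signum1\<close> is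
  the identity.\<close>

lemma AE_sign:
  assumes "a \<in> Idx"
  shows "AE \<omega> in measure_pmf p. snd (\<omega> (fst a) (snd a)) = sign_at a \<omega>"
proof -
  let ?v = "\<lambda>\<omega> :: nat \<Rightarrow> nat \<Rightarrow> nat \<times> real. snd (\<omega> (fst a) (snd a))"
  have "{\<omega>. ?v \<omega> = 1 \<or> ?v \<omega> = -1} = {\<omega>. ?v \<omega> = 1} \<union> {\<omega>. ?v \<omega> = -1}"
    by auto
  then have "measure_pmf.prob p {\<omega>. ?v \<omega> = 1 \<or> ?v \<omega> = -1} =
      measure_pmf.prob p {\<omega>. ?v \<omega> = 1} + measure_pmf.prob p {\<omega>. ?v \<omega> = -1}"
    by (simp only:) (intro measure_pmf.finite_measure_Union, auto)
  also have "\<dots> = 1"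
    using assms by (auto simp: prob_sign_pos prob_sign_neg)
  finally have "AE \<omega> in measure_pmf p. ?v \<omega> = 1 \<or> ?v \<omega> = -1"
    using measure_pmf.prob_Collect_eq_1[of p "\<lambda>\<omega>. ?v \<omega> = 1 \<or> ?v \<omega> = -1"] by simp
  then show ?thesis
    by eventually_elim (auto simp: sign_at_def signum1_def)
qed

lemma expectation_sign:
  assumes "a \<in> Idx"
  shows "measure_pmf.expectation p (sign_at a) = 0"
proof -
  have "sign_at a = (\<lambda>\<omega>. 2 * indicator {\<omega>. snd (\<omega> (fst a) (snd a)) = 1} \<omega> - 1)"
    by (auto simp: sign_at_def signum1_def indicator_def)
  moreover have "integrable (measure_pmf p)
      (\<lambda>\<omega>. 2 * indicator {\<omega>. snd (\<omega> (fst a) (snd a)) = 1} \<omega> :: real)"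
    by (rule measure_pmf_integrable_bounded[where B = 2]) (simp add: indicator_def)
  ultimately show ?thesis
    using assms by (simp add: prob_sign_pos mem_Times_iff)
qed

section \<open>Vanishing of mixed sign moments\<close>

text \<open>The factor \<open>w\<close> keeps a sign if it belongs to the same sketch as
  \<open>a\<close> and replaces it by 1 otherwise. What remains involves at most four columns of one
  sign function, so 4-wise independence splits off the mean of \<open>sign_at a\<close>, which is
  0.\<close>

lemma expectation_sign_block:
  assumes "a \<in> Idx" "b \<in> Idx" "c \<in> Idx" "d \<in> Idx" "a \<notin> {b, c, d}"
  defines "w \<equiv> \<lambda>x \<omega>. if fst x = fst a then sign_at x \<omega> else 1"
  shows "measure_pmf.expectation p (\<lambda>\<omega>. sign_at a \<omega> * (w b \<omega> * w c \<omega> * w d \<omega>)) = 0"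
proof -
  define i j where "i = fst a" and "j = snd a"
  define B where "B = snd ` {x \<in> {b, c, d}. fst x = i}"
  define wv :: "nat \<times> nat \<Rightarrow> (nat \<Rightarrow> real) \<Rightarrow> real"
    where "wv = (\<lambda>x v. if fst x = i then signum1 (v (snd x)) else 1)"
  have i: "i < \<tau>" and j: "j < n"
    using assms(1) by (auto simp: i_def j_def)
  \<comment> \<open>An index of sketch \<open>i\<close> with column \<open>j\<close> would be
    \<open>a\<close> itself.\<close>
  have jB: "j \<notin> B"
    using assms(5) by (auto simp: B_def i_def j_def prod_eq_iff)
  have B: "x \<in> {b, c, d} \<Longrightarrow> fst x = i \<Longrightarrow> snd x \<in> B" for x
    by (auto simp: B_def)
  have "card B \<le> card {x \<in> {b, c, d}. fst x = i}"
    unfolding B_def by (rule card_image_le) simp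
  also have "\<dots> \<le> card {b, c, d}"
    by (rule card_mono) auto
  also have "\<dots> \<le> 3"
    by (simp add: card_insert_if)
  \<comment> \<open>One column for \<open>a\<close> and at most three for the others; repetitions
    among \<open>b\<close>, \<open>c\<close>, \<open>d\<close> only make the set smaller.\<close>
  finally have "card (insert j B) \<le> 4"
    using card_insert_le_m1[of 4 B j] by simp
  moreover have "insert j B \<subseteq> {..<n}"
    using j assms(2-4) by (auto simp: B_def)
  ultimately have ind: "prob_space.indep_vars (measure_pmf p) (\<lambda>_. count_space UNIV)
      (\<lambda>k \<omega>. snd (\<omega> i k)) (insert j B)"
    using indep_sign i by blast
  let ?f = "\<lambda>v. signum1 (v j)" and ?g = "\<lambda>v. wv b v * wv c v * wv d v"
  let ?R = "\<lambda>A \<omega>. restrict (\<lambda>k. snd (\<omega> i k)) A"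
  have wm: "wv x \<in> borel_measurable (PiM B (\<lambda>_. count_space UNIV))" if "x \<in> {b, c, d}" for x
    using B[OF that] by (cases "fst x = i") (auto simp: wv_def intro!: borel_measurable_PiM_component)
  have "measure_pmf.expectation p (\<lambda>\<omega>. ?f (?R {j} \<omega>) * ?g (?R B \<omega>)) =
      measure_pmf.expectation p (\<lambda>\<omega>. ?f (?R {j} \<omega>)) * measure_pmf.expectation p (\<lambda>\<omega>. ?g (?R B \<omega>))"
    by (intro measure_pmf.expectation_mult_disjoint[OF ind] borel_measurable_PiM_component
        borel_measurable_times wm abs_mult_le_1)
      (use jB in \<open>auto simp: wv_def\<close>)
  moreover have "measure_pmf.expectation p (\<lambda>\<omega>. ?f (?R {j} \<omega>)) = 0"
    using expectation_sign[OF assms(1)] by (simp add: sign_at_def[abs_def] i_def j_def)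
  moreover have "wv x (?R B \<omega>) = w x \<omega>" if "x \<in> {b, c, d}" for x \<omega>
    using B[OF that] by (simp add: wv_def w_def sign_at_def i_def)
  ultimately show ?thesis
    by (simp add: sign_at_def[of a] i_def j_def)
qed

text \<open>The sign block of \<open>a\<close> is independent of all other blocks, so the expectation splits off a
  factor that involves only this block, and that factor vanishes by 4-wise independence within it.\<close>

lemma expectation_collide_sign_eq_0:
  assumes "a \<in> Idx" "b \<in> Idx" "c \<in> Idx" "d \<in> Idx" "a \<notin> {b, c, d}"
    and "e \<in> Idx" "e' \<in> Idx" "f \<in> Idx" "f' \<in> Idx"
  shows "measure_pmf.expectation p (\<lambda>\<omega>.
    collide t (hash_at e \<omega>) (hash_at e' \<omega>) * collide t (hash_at f \<omega>) (hash_at f' \<omega>) *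
    (sign_at a \<omega> * sign_at b \<omega> * sign_at c \<omega> * sign_at d \<omega>)) = 0"
proof -
  define i j where "i = fst a" and "j = snd a"
  \<comment> \<open>\<open>A\<close> holds the sign block of sketch \<open>i\<close>;
    \<open>B\<close> holds every other block, including the hash block of the same sketch.\<close>
  define A where "A = {(i, True)}"
  define B where "B = {..<\<tau>} \<times> UNIV - {(i, True)}"
  define s :: "nat \<times> nat \<Rightarrow> (nat \<times> bool \<Rightarrow> nat \<Rightarrow> nat \<times> real) \<Rightarrow> real"
    where "s = (\<lambda>x v. signum1 (snd (v (fst x, True) (snd x))))"
  define h :: "nat \<times> nat \<Rightarrow> (nat \<times> bool \<Rightarrow> nat \<Rightarrow> nat \<times> real) \<Rightarrow> nat"
    where "h = (\<lambda>x v. fst (v (fst x, False) (snd x)))"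
  \<comment> \<open>Each sign is the product of a part read from \<open>A\<close> and a part read
    from \<open>B\<close>, one of which is the constant 1.\<close>
  define w1 where "w1 = (\<lambda>x v. if fst x = i then s x v else 1)"
  define w2 where "w2 = (\<lambda>x v. if fst x = i then 1 else s x v)"
  define w where "w = (\<lambda>x \<omega>. if fst x = i then sign_at x \<omega> else 1)"
  define w' where "w' = (\<lambda>x \<omega>. if fst x = i then 1 else sign_at x \<omega>)"
  let ?f = "\<lambda>v. s a v * (w1 b v * w1 c v * w1 d v)"
  let ?g = "\<lambda>v. collide t (h e v) (h e' v) * collide t (h f v) (h f' v) *
    (w2 b v * w2 c v * w2 d v)"
  let ?R = "\<lambda>A \<omega>. restrict (\<lambda>ib. cs_block n ib \<omega>) A"
  have i: "i < \<tau>" using assms(1) by (auto simp: i_def)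
  have sA: "s x \<in> borel_measurable (PiM A (\<lambda>_. count_space UNIV))" if "fst x = i" for x
    unfolding s_def using that by (intro borel_measurable_PiM_component) (auto simp: A_def)
  have sB: "s x \<in> borel_measurable (PiM B (\<lambda>_. count_space UNIV))" if "fst x \<noteq> i" "x \<in> Idx" for x
    unfolding s_def using that by (intro borel_measurable_PiM_component) (auto simp: B_def)
  have w1m: "w1 x \<in> borel_measurable (PiM A (\<lambda>_. count_space UNIV))" for x
    using sA by (cases "fst x = i") (auto simp: w1_def)
  have w2m: "w2 x \<in> borel_measurable (PiM B (\<lambda>_. count_space UNIV))" if "x \<in> Idx" for x
    using sB that by (cases "fst x = i") (auto simp: w2_def)
  have cm: "(\<lambda>v. collide t (h x v) (h y v)) \<in> borel_measurable (PiM B (\<lambda>_. count_space UNIV))"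
    if "x \<in> Idx" "y \<in> Idx" for x y
    \<comment> \<open>Unfolding to the sum over buckets leaves products of functions of one block
      each, so measurability of single components suffices.\<close>
    unfolding collide_def h_def using that
    by (intro borel_measurable_sum borel_measurable_times
        borel_measurable_PiM_component[where u = "\<lambda>z. of_bool (fst (z _) = _)"]) (auto simp: B_def)
  have "measure_pmf.expectation p (\<lambda>\<omega>. ?f (?R A \<omega>) * ?g (?R B \<omega>)) =
      measure_pmf.expectation p (\<lambda>\<omega>. ?f (?R A \<omega>)) * measure_pmf.expectation p (\<lambda>\<omega>. ?g (?R B \<omega>))"
    by (intro measure_pmf.expectation_mult_disjoint[OF indep_blocks]
        borel_measurable_times w1m w2m sA cm abs_mult_le_1 abs_collide_le assms)
      (use i in \<open>auto simp: A_def B_def i_def s_def w1_def w2_def\<close>)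
  moreover have s1: "s x (?R A \<omega>) = sign_at x \<omega>" if "fst x = i" "x \<in> Idx" for x \<omega>
    using that by (auto simp: s_def A_def cs_block_def sign_at_def)
  have w1: "w1 x (?R A \<omega>) = w x \<omega>" if "x \<in> Idx" for x \<omega>
    using s1 that by (simp add: w1_def w_def)
  have w2: "w2 x (?R B \<omega>) = w' x \<omega>" if "x \<in> Idx" for x \<omega>
    using that by (auto simp: w2_def w'_def s_def B_def cs_block_def sign_at_def)
  \<comment> \<open>Every hash block lies in \<open>B\<close>, because its flag is
    \<open>False\<close>; so both collision factors go entirely to the second function.\<close>
  have h: "h x (?R B \<omega>) = hash_at x \<omega>" if "x \<in> Idx" for x \<omega>
    using that by (auto simp: h_def B_def cs_block_def hash_at_def)
  have ww: "sign_at x \<omega> = w x \<omega> * w' x \<omega>" for x \<omega>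
    by (simp add: w_def w'_def)
  have fA: "?f (?R A \<omega>) = sign_at a \<omega> * (w b \<omega> * w c \<omega> * w d \<omega>)" for \<omega>
    using assms s1[of a] by (simp add: w1 i_def)
  have "measure_pmf.expectation p (\<lambda>\<omega>. ?f (?R A \<omega>)) = 0"
    unfolding fA w_def i_def by (rule expectation_sign_block) (use assms in auto)
  ultimately have "measure_pmf.expectation p (\<lambda>\<omega>. ?f (?R A \<omega>) * ?g (?R B \<omega>)) = 0"
    by simp
  also have "(\<lambda>\<omega>. ?f (?R A \<omega>) * ?g (?R B \<omega>)) = (\<lambda>\<omega>.
      collide t (hash_at e \<omega>) (hash_at e' \<omega>) * collide t (hash_at f \<omega>) (hash_at f' \<omega>) *
      (sign_at a \<omega> * sign_at b \<omega> * sign_at c \<omega> * sign_at d \<omega>))"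
    unfolding fA using assms by (simp add: w2 h ww[of b] ww[of c] ww[of d] mult_ac)
  finally show ?thesis .
qed

section \<open>Collision probabilities\<close>

lemma expectation_hash_eq:
  assumes "a \<in> Idx" "k < t"
  shows "measure_pmf.expectation p (\<lambda>\<omega>. of_bool (hash_at a \<omega> = k)) = 1 / real t"
proof -
  have "(\<lambda>\<omega>. of_bool (hash_at a \<omega> = k) :: real) = indicator {\<omega>. fst (\<omega> (fst a) (snd a)) = k}"
    by (auto simp: hash_at_def indicator_def)
  then show ?thesis
    using assms by (simp add: prob_hash mem_Times_iff)
qed

text \<open>Distinct indices in the same sketch have distinct columns, so 2-wise independence of
  that hash function applies; indices in different sketches are covered by independence of the
  blocks.\<close>

lemma expectation_hash_pair:
  assumes "a \<in> Idx" "b \<in> Idx" "a \<noteq> b"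
  shows "measure_pmf.expectation p (\<lambda>\<omega>. of_bool (hash_at a \<omega> = k) * of_bool (hash_at b \<omega> = l) :: real) =
    measure_pmf.expectation p (\<lambda>\<omega>. of_bool (hash_at a \<omega> = k)) *
    measure_pmf.expectation p (\<lambda>\<omega>. of_bool (hash_at b \<omega> = l))"
proof (cases "fst a = fst b")
  case True
  then have ne: "snd a \<noteq> snd b"
    using assms(3) by (simp add: prod_eq_iff)
  have ind: "prob_space.indep_vars (measure_pmf p) (\<lambda>_. count_space UNIV)
      (\<lambda>k \<omega>. fst (\<omega> (fst a) k)) {snd a, snd b}"
    by (rule indep_hash) (use assms in \<open>auto simp: card_insert_if\<close>)
  let ?u = "\<lambda>x k (v :: nat \<Rightarrow> nat). of_bool (v (snd x) = k) :: real"
  let ?R = "\<lambda>x \<omega>. restrict (\<lambda>k. fst (\<omega> (fst a) k)) {snd x}"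
  have "measure_pmf.expectation p (\<lambda>\<omega>. ?u a k (?R a \<omega>) * ?u b l (?R b \<omega>)) =
      measure_pmf.expectation p (\<lambda>\<omega>. ?u a k (?R a \<omega>)) *
      measure_pmf.expectation p (\<lambda>\<omega>. ?u b l (?R b \<omega>))"
    by (intro measure_pmf.expectation_mult_disjoint[OF ind]
        borel_measurable_PiM_component[where u = "\<lambda>z. of_bool (z = _)"]) (use ne in auto)
  then show ?thesis
    using True by (simp add: hash_at_def)
next
  case False
  let ?u = "\<lambda>x k (v :: nat \<times> bool \<Rightarrow> nat \<Rightarrow> nat \<times> real).
    of_bool (fst (v (fst x, False) (snd x)) = k) :: real"
  let ?R = "\<lambda>x \<omega>. restrict (\<lambda>ib. cs_block n ib \<omega>) {(fst x, False)}"
  have "measure_pmf.expectation p (\<lambda>\<omega>. ?u a k (?R a \<omega>) * ?u b l (?R b \<omega>)) =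
      measure_pmf.expectation p (\<lambda>\<omega>. ?u a k (?R a \<omega>)) *
      measure_pmf.expectation p (\<lambda>\<omega>. ?u b l (?R b \<omega>))"
    by (intro measure_pmf.expectation_mult_disjoint[OF indep_blocks]
        borel_measurable_PiM_component[where u = "\<lambda>z. of_bool (fst (z _) = _)"])
      (use False assms in auto)
  then show ?thesis
    using assms by (auto simp: hash_at_def cs_block_def)
qed

text \<open>Each of the \<open>t\<close> buckets receives both indices with probability
  \<open>1/t * 1/t\<close>.\<close>

lemma expectation_collide:
  assumes "a \<in> Idx" "b \<in> Idx" "a \<noteq> b"
  shows "measure_pmf.expectation p (\<lambda>\<omega>. collide t (hash_at a \<omega>) (hash_at b \<omega>)) = 1 / real t"
proof -
  have "measure_pmf.expectation p (\<lambda>\<omega>. collide t (hash_at a \<omega>) (hash_at b \<omega>)) =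
      (\<Sum>k<t. measure_pmf.expectation p
        (\<lambda>\<omega>. of_bool (hash_at a \<omega> = k) * of_bool (hash_at b \<omega> = k)))"
    unfolding collide_def
    by (rule Bochner_Integration.integral_sum) (rule measure_pmf_integrable_bounded[where B = 1], simp)
  also have "\<dots> = (\<Sum>k<t. 1 / real t * (1 / real t))"
    by (intro sum.cong refl) (use assms in \<open>simp add: expectation_hash_pair expectation_hash_eq\<close>)
  finally show ?thesis
    using t_pos by simp
qed

section \<open>Second moment of the off-diagonal sum\<close>

text \<open>The pairs are ordered, so each unordered pair is counted twice. This is the source of
  the factor 2 in the second moment.\<close>

definition off_diag :: "((nat \<times> nat) \<times> (nat \<times> nat)) set" where
  "off_diag = {e \<in> Idx \<times> Idx. fst e \<noteq> snd e}"

definition cross :: "(nat \<times> nat) \<times> (nat \<times> nat) \<Rightarrow> (nat \<Rightarrow> nat \<Rightarrow> nat \<times> real) \<Rightarrow> real" where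
  "cross e \<omega> = collide t (hash_at (fst e) \<omega>) (hash_at (snd e) \<omega>) *
    (sign_at (fst e) \<omega> * sign_at (snd e) \<omega>)"

lemma finite_off_diag [simp]: "finite off_diag"
  by (simp add: off_diag_def)

lemma abs_cross_le: "\<bar>cross e \<omega>\<bar> \<le> 1"
  by (simp add: cross_def abs_mult abs_collide_le)

lemma cross_swap: "cross (prod.swap e) \<omega> = cross e \<omega>"
  by (simp add: cross_def collide_commute mult.commute)

text \<open>The signs square to 1 and the collision indicator is idempotent.\<close>

lemma cross_square: "cross e \<omega> * cross e \<omega> = collide t (hash_at (fst e) \<omega>) (hash_at (snd e) \<omega>)"
proof -
  have "cross e \<omega> * cross e \<omega> = (collide t (hash_at (fst e) \<omega>) (hash_at (snd e) \<omega>))\<^sup>2 *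
      (sign_at (fst e) \<omega> * sign_at (fst e) \<omega>) * (sign_at (snd e) \<omega> * sign_at (snd e) \<omega>)"
    unfolding cross_def power2_eq_square by (simp only: mult_ac)
  then show ?thesis
    by (simp add: collide_eq)
qed

text \<open>Up to order, equal pairs give the square of a cross term, whose mean is the collision
  probability. For any other two pairs some index occurs exactly once among the four, and its sign
  makes the mean vanish.\<close>

lemma expectation_cross_mult:
  assumes "e \<in> off_diag" "f \<in> off_diag"
  shows "measure_pmf.expectation p (\<lambda>\<omega>. cross e \<omega> * cross f \<omega>) =
    (if f = e \<or> f = prod.swap e then 1 / real t else 0)"
proof (cases "f = e \<or> f = prod.swap e")
  case True
  then have "(\<lambda>\<omega>. cross e \<omega> * cross f \<omega>) =
      (\<lambda>\<omega>. collide t (hash_at (fst e) \<omega>) (hash_at (snd e) \<omega>))"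
    by (auto simp: cross_swap cross_square)
  then show ?thesis
    using True assms by (auto simp: off_diag_def expectation_collide)
next
  case False
  obtain a b c d where ef: "e = (a, b)" "f = (c, d)"
    by (metis surj_pair)
  have I: "a \<in> Idx" "b \<in> Idx" "c \<in> Idx" "d \<in> Idx" "a \<noteq> b" "c \<noteq> d"
    using assms by (auto simp: ef off_diag_def)
  \<comment> \<open>If both \<open>a\<close> and \<open>b\<close> recurred, then both would lie in
    \<open>{c, d}\<close>; being distinct, they would make \<open>f\<close> equal to
    \<open>e\<close> or to its swap.\<close>
  have "a \<notin> {b, c, d} \<or> b \<notin> {a, c, d}"
    using False I by (auto simp: ef)
  then have "measure_pmf.expectation p (\<lambda>\<omega>. cross e \<omega> * cross f \<omega>) = 0"
  proof
    assume "a \<notin> {b, c, d}"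
    from expectation_collide_sign_eq_0[OF I(1-4) this I(1-4)] show ?thesis
      by (simp add: cross_def ef mult_ac)
  next
    assume "b \<notin> {a, c, d}"
    from expectation_collide_sign_eq_0[OF I(2) I(1) I(3,4) this I(1-4)] show ?thesis
      by (simp add: cross_def ef mult_ac)
  qed
  then show ?thesis
    using False by simp
qed

definition noise :: "(nat \<times> nat \<Rightarrow> real) \<Rightarrow> (nat \<Rightarrow> nat \<Rightarrow> nat \<times> real) \<Rightarrow> real" where
  "noise z \<omega> = (\<Sum>e\<in>off_diag. z (fst e) * z (snd e) * cross e \<omega>)"

text \<open>After expanding the square, only \<open>e\<close> and its swap survive in the inner sum
  for \<open>e\<close>. The weight \<open>y\<close> is symmetric under swapping, so the two terms
  are equal.\<close>

lemma expectation_noise_square_le: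
  "measure_pmf.expectation p (\<lambda>\<omega>. (noise z \<omega>)\<^sup>2) \<le> 2 / real t * (\<Sum>a\<in>Idx. (z a)\<^sup>2)\<^sup>2"
proof -
  define y where "y e = z (fst e) * z (snd e)" for e :: "(nat \<times> nat) \<times> (nat \<times> nat)"
  have "measure_pmf.expectation p (\<lambda>\<omega>. (noise z \<omega>)\<^sup>2) =
      measure_pmf.expectation p (\<lambda>\<omega>. \<Sum>e\<in>off_diag. \<Sum>f\<in>off_diag. y e * y f * (cross e \<omega> * cross f \<omega>))"
    by (simp add: noise_def power2_eq_square sum_product y_def mult_ac)
  also have "\<dots> = (\<Sum>e\<in>off_diag. \<Sum>f\<in>off_diag.
      y e * y f * measure_pmf.expectation p (\<lambda>\<omega>. cross e \<omega> * cross f \<omega>))"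
    by (simp add: Bochner_Integration.integral_sum integrable_sum
        measure_pmf_integrable_bounded[where B = 1] abs_mult_le_1 abs_cross_le)
  also have "\<dots> = (\<Sum>e\<in>off_diag. 2 / real t * (y e)\<^sup>2)"
  proof (rule sum.cong[OF refl])
    fix e assume e: "e \<in> off_diag"
    have sw: "prod.swap e \<in> off_diag" "prod.swap e \<noteq> e"
      using e by (auto simp: off_diag_def prod_eq_iff)
    have "(\<Sum>f\<in>off_diag. y e * y f * measure_pmf.expectation p (\<lambda>\<omega>. cross e \<omega> * cross f \<omega>)) =
        (\<Sum>f\<in>off_diag. if f \<in> {e, prod.swap e} then y e * y f / real t else 0)"
      by (rule sum.cong) (use e in \<open>auto simp: expectation_cross_mult\<close>)
    also have "\<dots> = (\<Sum>f\<in>{e, prod.swap e}. y e * y f / real t)"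
      by (subst sum.inter_restrict[symmetric]) (use e sw in \<open>auto intro!: sum.cong\<close>)
    also have "\<dots> = 2 / real t * (y e)\<^sup>2"
      using sw(2) by (simp add: y_def power2_eq_square mult_ac)
    finally show "(\<Sum>f\<in>off_diag. y e * y f * measure_pmf.expectation p (\<lambda>\<omega>. cross e \<omega> * cross f \<omega>)) =
        2 / real t * (y e)\<^sup>2" .
  qed
  \<comment> \<open>Adding the nonnegative diagonal terms completes the sum to a full product, the
    square of \<open>\<Sum>a\<in>Idx. (z a)\<^sup>2\<close>.\<close>
  also have "\<dots> \<le> (\<Sum>e\<in>Idx \<times> Idx. 2 / real t * (y e)\<^sup>2)"
    by (rule sum_mono2) (auto simp: off_diag_def)
  also have "\<dots> = 2 / real t * (\<Sum>a\<in>Idx. (z a)\<^sup>2)\<^sup>2"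
    unfolding sum_distrib_left[symmetric]
    by (simp add: power2_eq_square sum_product y_def sum.cartesian_product case_prod_unfold mult_ac)
  finally show ?thesis .
qed

section \<open>Concentration by Chebyshev's inequality\<close>

lemma prob_noise_le:
  fixes z defines "N \<equiv> \<Sum>a\<in>Idx. (z a)\<^sup>2"
  shows "measure_pmf.prob p {\<omega>. \<bar>noise z \<omega>\<bar> \<le> 15 / sqrt (real t) * N} \<ge> 99 / 100"
proof (cases "N = 0")
  \<comment> \<open>Here the threshold would be 0 and Chebyshev's inequality would divide by 0; but
    all \<open>z a\<close> vanish, and the noise with them.\<close>
  case True
  then have "z a = 0" if "a \<in> Idx" for a
    using that unfolding N_def by (subst (asm) sum_nonneg_eq_0_iff) auto
  then have "noise z \<omega> = 0" for \<omega>
    unfolding noise_def by (intro sum.neutral) (auto simp: off_diag_def)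
  then show ?thesis
    using True by simp
next
  case False
  moreover have "N \<ge> 0"
    unfolding N_def by (rule sum_nonneg) simp
  ultimately have N: "N > 0"
    by simp
  \<comment> \<open>With this threshold \<open>t\<close> and \<open>N\<close> cancel in the
    Chebyshev quotient, leaving \<open>2/225\<close>. The constant 15 is the least integer whose
    square is at least 200, as a failure probability of \<open>1/100\<close> demands.\<close>
  define r where "r = 15 / sqrt (real t) * N"
  have r: "r > 0" and r2: "r\<^sup>2 = 225 / real t * N\<^sup>2"
    using N t_pos by (auto simp: r_def power_mult_distrib power_divide)
  \<comment> \<open>A bound uniform in the outcome, from which integrability of the squared noise
    follows.\<close>
  have bound: "\<bar>noise z \<omega>\<bar> \<le> (\<Sum>e\<in>off_diag. \<bar>z (fst e) * z (snd e)\<bar>)" for \<omega>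
    unfolding noise_def
    by (rule order_trans[OF sum_abs], rule sum_mono)
      (use abs_cross_le in \<open>simp add: abs_mult mult_left_le\<close>)
  have "integrable (measure_pmf p) (\<lambda>\<omega>. (noise z \<omega>)\<^sup>2)"
    by (rule measure_pmf_integrable_bounded[where B = "(\<Sum>e\<in>off_diag. \<bar>z (fst e) * z (snd e)\<bar>)\<^sup>2"])
      (use power_mono[OF bound abs_ge_zero, of _ 2] in \<open>simp only: power2_abs abs_power2\<close>)
  then have "measure_pmf.prob p {\<omega>. r \<le> \<bar>noise z \<omega>\<bar>} \<le>
      measure_pmf.expectation p (\<lambda>\<omega>. (noise z \<omega>)\<^sup>2) / r\<^sup>2"
    using measure_pmf.second_moment_method[of "noise z" p r] r by simp
  also have "\<dots> \<le> 2 / real t * N\<^sup>2 / r\<^sup>2"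
    unfolding N_def by (intro divide_right_mono expectation_noise_square_le) simp
  also have "\<dots> = 2 / 225"
    using N t_pos by (simp add: r2)
  finally have "measure_pmf.prob p {\<omega>. r \<le> \<bar>noise z \<omega>\<bar>} \<le> 1 / 100"
    by simp
  moreover have "measure_pmf.prob p (UNIV - {\<omega>. r \<le> \<bar>noise z \<omega>\<bar>}) =
      1 - measure_pmf.prob p {\<omega>. r \<le> \<bar>noise z \<omega>\<bar>}"
    using measure_pmf.prob_compl[of "{\<omega>. r \<le> \<bar>noise z \<omega>\<bar>}" p] by simp
  moreover have "measure_pmf.prob p (UNIV - {\<omega>. r \<le> \<bar>noise z \<omega>\<bar>}) \<le>
      measure_pmf.prob p {\<omega>. \<bar>noise z \<omega>\<bar> \<le> r}"
    by (rule measure_pmf.finite_measure_mono) auto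
  ultimately show ?thesis
    unfolding r_def by linarith
qed

section \<open>Squared norm of the sketch as main term plus noise\<close>

text \<open>A pointwise identity for a single outcome with hash values in range and genuine signs.
  Squaring each bucket gives a sum over ordered pairs of indices; its diagonal is the main term and
  the rest is the noise.\<close>

lemma sqnorm_sketch_eq:
  assumes h: "\<And>a. a \<in> Idx \<Longrightarrow> hash_at a \<omega> < t"
    and s: "\<And>a. a \<in> Idx \<Longrightarrow> snd (\<omega> (fst a) (snd a)) = sign_at a \<omega>"
  shows "sqnorm t (\<lambda>k. \<Sum>i<\<tau>. c i *
      countsketch_apply n (\<lambda>j. fst (\<omega> i j)) (\<lambda>j. snd (\<omega> i j)) (x i) k) =
    (\<Sum>a\<in>Idx. (c (fst a) * x (fst a) (snd a))\<^sup>2) + noise (\<lambda>a. c (fst a) * x (fst a) (snd a)) \<omega>"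
proof -
  define z where "z a = c (fst a) * x (fst a) (snd a)" for a :: "nat \<times> nat"
  define u where "u a = sign_at a \<omega> * z a" for a :: "nat \<times> nat"
  have "(\<Sum>i<\<tau>. c i * countsketch_apply n (\<lambda>j. fst (\<omega> i j)) (\<lambda>j. snd (\<omega> i j)) (x i) k) =
      (\<Sum>a\<in>Idx. of_bool (hash_at a \<omega> = k) * u a)" for k
  proof -
    have "c i * countsketch_apply n (\<lambda>j. fst (\<omega> i j)) (\<lambda>j. snd (\<omega> i j)) (x i) k =
        (\<Sum>j<n. of_bool (hash_at (i, j) \<omega> = k) * u (i, j))" if "i < \<tau>" for i
    proof -
      have "countsketch_apply n (\<lambda>j. fst (\<omega> i j)) (\<lambda>j. snd (\<omega> i j)) (x i) k =
          (\<Sum>j\<in>{j \<in> {..<n}. fst (\<omega> i j) = k}. snd (\<omega> i j) * x i j)"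
        by (simp add: countsketch_apply_def)
      also have "\<dots> = (\<Sum>j<n. if fst (\<omega> i j) = k then snd (\<omega> i j) * x i j else 0)"
        by (rule sum.inter_filter) simp
      finally show ?thesis
        by (simp only: sum_distrib_left, intro sum.cong refl)
          (use s[of "(i, _)"] that in \<open>auto simp: u_def z_def hash_at_def\<close>)
    qed
    then have "(\<Sum>i<\<tau>. c i * countsketch_apply n (\<lambda>j. fst (\<omega> i j)) (\<lambda>j. snd (\<omega> i j)) (x i) k) =
        (\<Sum>i<\<tau>. \<Sum>j<n. of_bool (hash_at (i, j) \<omega> = k) * u (i, j))"
      by (intro sum.cong refl) blast
    then show ?thesis
      by (simp only: sum.cartesian_product case_prod_unfold prod.collapse)
  qed
  then have "sqnorm t (\<lambda>k. \<Sum>i<\<tau>. c i *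
      countsketch_apply n (\<lambda>j. fst (\<omega> i j)) (\<lambda>j. snd (\<omega> i j)) (x i) k) =
      (\<Sum>k<t. (\<Sum>a\<in>Idx. of_bool (hash_at a \<omega> = k) * u a) * (\<Sum>a\<in>Idx. of_bool (hash_at a \<omega> = k) * u a))"
    by (simp only: sqnorm_def power2_eq_square)
  also have "\<dots> = (\<Sum>k<t. \<Sum>e\<in>Idx \<times> Idx. of_bool (hash_at (fst e) \<omega> = k) * of_bool (hash_at (snd e) \<omega> = k) *
        (u (fst e) * u (snd e)))"
    by (rule sum.cong[OF refl])
      (simp only: sum_product sum.cartesian_product case_prod_unfold mult_ac)
  \<comment> \<open>Summing over the buckets first turns the two bucket indicators into the
    collision indicator.\<close>
  also have "\<dots> = (\<Sum>e\<in>Idx \<times> Idx.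
      collide t (hash_at (fst e) \<omega>) (hash_at (snd e) \<omega>) * (u (fst e) * u (snd e)))"
    by (subst sum.swap) (simp only: collide_def sum_distrib_right)
  also have "\<dots> = (\<Sum>e\<in>Idx \<times> Idx. z (fst e) * z (snd e) * cross e \<omega>)"
    by (simp add: u_def cross_def mult_ac)
  also have "\<dots> = (\<Sum>e\<in>Idx \<times> Idx - off_diag. z (fst e) * z (snd e) * cross e \<omega>) + noise z \<omega>"
    unfolding noise_def by (rule sum.subset_diff) (auto simp: off_diag_def)
  also have "Idx \<times> Idx - off_diag = (\<lambda>a. (a, a)) ` Idx"
    by (auto simp: off_diag_def)
  also have "(\<Sum>e\<in>(\<lambda>a. (a, a)) ` Idx. z (fst e) * z (snd e) * cross e \<omega>) =
      (\<Sum>a\<in>Idx. z a * z a * cross (a, a) \<omega>)"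
    by (subst sum.reindex) (auto simp: inj_on_def)
  \<comment> \<open>An index collides with itself because its hash value is below \<open>t\<close>,
    and its sign squares to 1.\<close>
  also have "\<dots> = (\<Sum>a\<in>Idx. (z a)\<^sup>2)"
    by (rule sum.cong) (auto simp: cross_def collide_eq h power2_eq_square)
  finally show ?thesis
    by (simp add: z_def[abs_def])
qed

text \<open>Here \<open>x i\<close> stands for the vector \<open>W_i \<theta>\<close>. The error
  equals the noise almost surely, so the tail bound for the noise carries over.\<close>

lemma prob_sketch_error_le:
  fixes \<alpha> :: "nat \<Rightarrow> real" and x :: "nat \<Rightarrow> nat \<Rightarrow> real"
  assumes "\<And>i. i < \<tau> \<Longrightarrow> \<alpha> i \<ge> 0"
  defines "N \<equiv> \<Sum>i<\<tau>. \<alpha> i * sqnorm n (x i)"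
  shows "measure_pmf.prob p
      {\<omega>. \<bar>sqnorm t (\<lambda>k. \<Sum>i<\<tau>. sqrt (\<alpha> i) *
            countsketch_apply n (\<lambda>j. fst (\<omega> i j)) (\<lambda>j. snd (\<omega> i j)) (x i) k) - N\<bar>
          \<le> 15 / sqrt (real t) * N} \<ge> 99 / 100"
proof -
  \<comment> \<open>The weight is absorbed into the entries; since \<open>\<alpha> i\<close> is
    nonnegative, its root squares back and the sum of squares of \<open>z\<close> is
    \<open>N\<close>.\<close>
  define z where "z a = sqrt (\<alpha> (fst a)) * x (fst a) (snd a)" for a :: "nat \<times> nat"
  have "(\<Sum>a\<in>Idx. (z a)\<^sup>2) = (\<Sum>i<\<tau>. \<Sum>j<n. (z (i, j))\<^sup>2)"
    by (simp only: sum.cartesian_product case_prod_unfold prod.collapse)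
  also have "\<dots> = N"
    using assms(1) by (simp add: N_def z_def sqnorm_def sum_distrib_left power_mult_distrib)
  finally have N: "N = (\<Sum>a\<in>Idx. (z a)\<^sup>2)" ..
  \<comment> \<open>The index set is finite, so the exceptional null sets can be united.\<close>
  have "AE \<omega> in measure_pmf p. \<forall>a\<in>Idx. hash_at a \<omega> < t \<and> snd (\<omega> (fst a) (snd a)) = sign_at a \<omega>"
    by (intro AE_finite_allI AE_conjI AE_hash_less AE_sign) auto
  then have "AE \<omega> in measure_pmf p.
      sqnorm t (\<lambda>k. \<Sum>i<\<tau>. sqrt (\<alpha> i) *
        countsketch_apply n (\<lambda>j. fst (\<omega> i j)) (\<lambda>j. snd (\<omega> i j)) (x i) k) = N + noise z \<omega>"
    unfolding N z_def[abs_def] by eventually_elim (rule sqnorm_sketch_eq; blast)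
  then have "measure_pmf.prob p {\<omega>. \<bar>noise z \<omega>\<bar> \<le> 15 / sqrt (real t) * N} =
    measure_pmf.prob p
      {\<omega>. \<bar>sqnorm t (\<lambda>k. \<Sum>i<\<tau>. sqrt (\<alpha> i) *
            countsketch_apply n (\<lambda>j. fst (\<omega> i j)) (\<lambda>j. snd (\<omega> i j)) (x i) k) - N\<bar>
          \<le> 15 / sqrt (real t) * N}"
    by (intro measure_pmf.finite_measure_eq_AE) (auto elim!: eventually_mono)
  then show ?thesis
    using prob_noise_le[of z] unfolding N by simp
qed

end

theorem theorem2:
  shows "\<exists>C::real. C > 0 \<and>
    (\<forall>(\<tau>::nat) (n::nat) (m::nat) (t::nat)
       (W :: nat \<Rightarrow> nat \<Rightarrow> nat \<Rightarrow> real) (\<alpha> :: nat \<Rightarrow> real)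
       (p :: (nat \<Rightarrow> nat \<Rightarrow> nat \<times> real) pmf) (\<theta> :: nat \<Rightarrow> real).
       0 < \<tau> \<longrightarrow> 0 < n \<longrightarrow> 0 < m \<longrightarrow> 0 < t \<longrightarrow>
       (\<forall>i<\<tau>. \<alpha> i \<ge> 0) \<longrightarrow>
       countsketch_family \<tau> n t p \<longrightarrow>
       measure_pmf.prob p
         {\<omega>. \<bar>sqnorm t (\<lambda>k. \<Sum>i<\<tau>. sqrt (\<alpha> i) *
                   countsketch_apply n (\<lambda>j. fst (\<omega> i j)) (\<lambda>j. snd (\<omega> i j))
                     (mat_vec m (W i) \<theta>) k)
              - (\<Sum>i<\<tau>. \<alpha> i * sqnorm n (mat_vec m (W i) \<theta>))\<bar>
            \<le> C / sqrt (real t) * (\<Sum>i<\<tau>. \<alpha> i * sqnorm n (mat_vec m (W i) \<theta>))}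
       \<ge> 99 / 100)"
\<comment> \<open>The witness is the constant from the Chebyshev bound; it depends on none of the
  parameters.\<close>
proof (intro exI[of _ 15] conjI allI impI)
  fix \<tau> n m t :: nat and W :: "nat \<Rightarrow> nat \<Rightarrow> nat \<Rightarrow> real" and \<alpha> \<theta> :: "nat \<Rightarrow> real"
    and p :: "(nat \<Rightarrow> nat \<Rightarrow> nat \<times> real) pmf"
  assume "0 < t" "\<forall>i<\<tau>. \<alpha> i \<ge> 0" "countsketch_family \<tau> n t p"
  then interpret countsketch \<tau> n t p
    by unfold_locales
  show "measure_pmf.prob p
         {\<omega>. \<bar>sqnorm t (\<lambda>k. \<Sum>i<\<tau>. sqrt (\<alpha> i) *
                   countsketch_apply n (\<lambda>j. fst (\<omega> i j)) (\<lambda>j. snd (\<omega> i j))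
                     (mat_vec m (W i) \<theta>) k)
              - (\<Sum>i<\<tau>. \<alpha> i * sqnorm n (mat_vec m (W i) \<theta>))\<bar>
            \<le> 15 / sqrt (real t) * (\<Sum>i<\<tau>. \<alpha> i * sqnorm n (mat_vec m (W i) \<theta>))}
       \<ge> 99 / 100"
    using \<open>\<forall>i<\<tau>. \<alpha> i \<ge> 0\<close> by (intro prob_sketch_error_le) auto
qed simp

end
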